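(* Let $f_i:\mathbb{R}^d\to\mathbb{R}$, $i\in[n]$, be differentiable and $L$-smooth. Assume the heavy-tailed noise condition: with $\mathcal{F}_{-1}=\{\Omega,\emptyset\}$ and $\mathcal{F}_t=\sigma(\{\boldsymbol{\xi}_i^0,\dots,\boldsymbol{\xi}_i^{t-1}:i\in[n]\})$, for every $\mathcal{F}_t$-measurable $\boldsymbol{x}$, all $i$ and $t\ge0$: $\mathbb{E}[\boldsymbol{g}_i(\boldsymbol{x},\boldsymbol{\xi}_i^t)\mid\mathcal{F}_t]=\nabla f_i(\boldsymbol{x})$, $\mathbb{E}[\|\boldsymbol{g}_i(\boldsymbol{x},\boldsymbol{\xi}_i^t)-\nabla f_i(\boldsymbol{x})\|^p\mid\mathcal{F}_t]\le\sigma^p$ for some $p\in(1,2]$, $\sigma\ge0$, and $\{\boldsymbol{\xi}_i^t\}$ independent. Let $\boldsymbol{W}=(w_{ir})$ be nonnegative, primitive, doubly stochastic, with $\lambda:=\|\boldsymbol{W}-\mathbf{1}_n\mathbf{1}_n^\top/n\|_2<1$. For the iterates of GT-NSGDm (described in the context) with $\alpha>0$ and $\beta\in(0,1)$, and $\bar{\boldsymbol{y}}^t=\frac1n\sum_i\boldsymbol{y}_i^t$, we have for all $t=0,\dots,T$: $$\frac1n\mathbb{E}\Big[\sum_{i=1}^n\|\boldsymbol{y}_i^t-\bar{\boldsymbol{y}}^t\|\Big]\le 2\sqrt2\,n^{1/2}\Big(\frac1\beta-1\Big)\Big(\sum_{k=0}^t\lambda^{(t-k+1)p}\Big)^{1/p}\sigma+\frac{1}{\sqrt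 n}\Big(\frac1\beta-1\Big)\sum_{k=0}^t\lambda^{t-k+1}\mathbb{E}\big[\|\nabla F(\boldsymbol{x}^k)-\boldsymbol{v}^k\|\big].$$
   Context: Algorithm GT-NSGDm (run in parallel at every node $i$): initialize $\boldsymbol{x}_i^{-1}=\boldsymbol{x}_i^0=\bar{\boldsymbol{x}}^0$ (a common point) and $\boldsymbol{v}_i^{-1}=\boldsymbol{y}_i^{-1}=\mathbf{0}_d$. For $t=0,\dots,T-1$: sample $\boldsymbol{\xi}_i^t$; set $\boldsymbol{v}_i^t=\beta\boldsymbol{v}_i^{t-1}+(1-\beta)\boldsymbol{g}_i(\boldsymbol{x}_i^t,\boldsymbol{\xi}_i^t)$; $\boldsymbol{y}_i^t=\sum_{r=1}^n w_{ir}(\boldsymbol{y}_r^{t-1}+\boldsymbol{v}_r^t-\boldsymbol{v}_r^{t-1})$; $\boldsymbol{x}_i^{t+1}=\sum_{r=1}^n w_{ir}\big(\boldsymbol{x}_r^t-\alpha\,\boldsymbol{y}_r^t/\|\boldsymbol{y}_r^t\|\big)$. Stacked vectors: $\boldsymbol{x}^k=[(\boldsymbol{x}_1^k)^\top,\dots,(\boldsymbol{x}_n^k)^\top]^\top$, $\boldsymbol{v}^k=[(\boldsymbol{v}_1^k)^\top,\dots,(\boldsymbol{v}_n^k)^\top]^\top$, $\nabla F(\boldsymbol{x}^k)=[\nabla f_1(\boldsymbol{x}_1^k)^\top,\dots,\nabla f_n(\boldsymbol{x}_n^k)^\top]^\top\in\mathbb{R}^{nd}$; norms are Euclidean. *)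

theory Defs
  imports "HOL-Analysis.Analysis" "HOL-Probability.Probability"
begin

(* matrix power W^k *)
fun mat_pow :: "real^'n^'n \<Rightarrow> nat \<Rightarrow> real^'n^'n" where
  "mat_pow W 0 = mat 1"
| "mat_pow W (Suc k) = W ** mat_pow W k"

(* primitive nonnegative matrix: some positive power is entrywise positive *)
definition primitive_matrix :: "real^'n^'n \<Rightarrow> bool" where
  "primitive_matrix W \<longleftrightarrow> (\<exists>k>0. \<forall>i j. (mat_pow W k) $ i $ j > 0)"

definition doubly_stochastic :: "real^'n::finite^'n \<Rightarrow> bool" where
  "doubly_stochastic W \<longleftrightarrow> (\<forall>i j. W $ i $ j \<ge> 0) \<and>
     (\<forall>i. (\<Sum>j\<in>UNIV. W $ i $ j) = 1) \<and> (\<forall>j. (\<Sum>i\<in>UNIV. W $ i $ j) = 1)"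

(* lambda = || W - 1 1^T / n ||_2  (spectral norm = operator norm w.r.t. Euclidean norm) *)
definition mix_lambda :: "real^'n::finite^'n \<Rightarrow> real" where
  "mix_lambda W = onorm (\<lambda>v. (\<chi> i j. W $ i $ j - 1 / real CARD('n)) *v v)"

(* natural filtration: F_t = sigma(xi_i^k : i node, k < t); F_0 is the trivial algebra *)
definition nat_filtr :: "'a measure \<Rightarrow> 's measure \<Rightarrow> ('n \<Rightarrow> nat \<Rightarrow> 'a \<Rightarrow> 's) \<Rightarrow> nat \<Rightarrow> 'a measure" where
  "nat_filtr M S \<xi> t = sigma (space M)
     {\<xi> i k -` A \<inter> space M | i k A. k < t \<and> A \<in> sets S}"

(* one step of GT-NSGDm: state (x^t, v^{t-1}, y^{t-1}) \<mapsto> (x^{t+1}, v^t, y^t),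
   using the samples xi^t (given as the sample vector s) *)
definition gt_step ::
  "real^'n::finite^'n \<Rightarrow> real \<Rightarrow> real \<Rightarrow> ('n \<Rightarrow> 'd::euclidean_space \<Rightarrow> 's \<Rightarrow> 'd) \<Rightarrow> ('n \<Rightarrow> 's)
   \<Rightarrow> ('n \<Rightarrow> 'd) \<times> ('n \<Rightarrow> 'd) \<times> ('n \<Rightarrow> 'd) \<Rightarrow> ('n \<Rightarrow> 'd) \<times> ('n \<Rightarrow> 'd) \<times> ('n \<Rightarrow> 'd)" where
  "gt_step W \<alpha> \<beta> g s st =
    (let x = fst st; vold = fst (snd st); yold = snd (snd st);
         v = (\<lambda>i. \<beta> *\<^sub>R vold i + (1 - \<beta>) *\<^sub>R g i (x i) (s i));
         y = (\<lambda>i. \<Sum>r\<in>UNIV. W $ i $ r *\<^sub>R (yold r + v r - vold r));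
         x' = (\<lambda>i. \<Sum>r\<in>UNIV. W $ i $ r *\<^sub>R (x r - \<alpha> *\<^sub>R ((1 / norm (y r)) *\<^sub>R y r)))
     in (x', v, y))"

(* gt_state t = (x^t, v^{t-1}, y^{t-1}); initial x^0 = x0, v^{-1} = y^{-1} = 0 *)
fun gt_state ::
  "real^'n::finite^'n \<Rightarrow> real \<Rightarrow> real \<Rightarrow> ('n \<Rightarrow> 'd::euclidean_space \<Rightarrow> 's \<Rightarrow> 'd) \<Rightarrow> 'd
   \<Rightarrow> ('n \<Rightarrow> nat \<Rightarrow> 's) \<Rightarrow> nat \<Rightarrow> ('n \<Rightarrow> 'd) \<times> ('n \<Rightarrow> 'd) \<times> ('n \<Rightarrow> 'd)" where
  "gt_state W \<alpha> \<beta> g x0 s 0 = ((\<lambda>_. x0), (\<lambda>_. 0), (\<lambda>_. 0))"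
| "gt_state W \<alpha> \<beta> g x0 s (Suc t) = gt_step W \<alpha> \<beta> g (\<lambda>i. s i t) (gt_state W \<alpha> \<beta> g x0 s t)"

definition gt_x where "gt_x W \<alpha> \<beta> g x0 s t = fst (gt_state W \<alpha> \<beta> g x0 s t)"
definition gt_v where "gt_v W \<alpha> \<beta> g x0 s t = fst (snd (gt_state W \<alpha> \<beta> g x0 s (Suc t)))"
definition gt_y where "gt_y W \<alpha> \<beta> g x0 s t = snd (snd (gt_state W \<alpha> \<beta> g x0 s (Suc t)))"

(* Euclidean norm of a stacked vector in R^{nd} *)
definition stack_norm :: "('n::finite \<Rightarrow> 'd::euclidean_space) \<Rightarrow> real" where
  "stack_norm z = sqrt (\<Sum>i\<in>UNIV. (norm (z i))\<^sup>2)"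

end

theory Submission
  imports Defs
begin

(* Write A = W - 1 1^T / n, \<epsilon>^k = g(x^k, \<xi>^k) - \<nabla>F(x^k) and \<delta>^k = \<nabla>F(x^k) - v^k.
   Since A annihilates constant vectors and v^k - v^(k-1) = (1/\<beta> - 1) (g^k - v^k), the
   deviation of y^t from its mean is (1/\<beta> - 1) (N^(t+1) + D^(t+1)), where N and D follow the
   recursion N^(k+1) = (A \<otimes> I) (N^k + \<epsilon>^k), D^(k+1) = (A \<otimes> I) (D^k + \<delta>^k).  D is bounded
   pathwise by \<Sum> \<lambda>^(t-k+1) \<parallel>\<delta>^k\<parallel>.  For N, the inequality
   \<parallel>x + y\<parallel>^p \<le> \<parallel>x\<parallel>^p + p \<parallel>x\<parallel>^(p-2) \<langle>x, y\<rangle> + 2^p \<parallel>y\<parallel>^p  (1 < p \<le> 2)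
   together with the conditional unbiasedness of \<epsilon>^k kills the cross term in expectation, so
   E \<parallel>N^(k+1)\<parallel>^p \<le> \<lambda>^p (E \<parallel>N^k\<parallel>^p + 2^p n \<sigma>^p).  Lyapunov's inequality E Z \<le> (E Z^p)^(1/p)
   and \<Sum>i \<parallel>z_i\<parallel> \<le> \<surd>n \<parallel>z\<parallel> turn this into the stated bound. *)

section \<open>Elementary inequalities\<close>

lemma powr_add_le_add_powr:
  fixes u v q :: real
  assumes "0 \<le> u" "0 \<le> v" "0 < q" "q \<le> 1"
  shows "(u + v) powr q \<le> u powr q + v powr q"
proof (cases "u + v = 0")
  case True
  then show ?thesis using assms by simp
next
  case False
  then have s: "u + v > 0" using assms by simp
  have frac_le: "w / (u + v) \<le> (w / (u + v)) powr q" if "0 \<le> w" "w \<le> u + v" for w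
    using powr_mono'[of q 1 "w / (u + v)"] that assms s by simp
  have "1 = u / (u + v) + v / (u + v)" using s by (simp add: add_divide_distrib[symmetric])
  also have "\<dots> \<le> (u / (u + v)) powr q + (v / (u + v)) powr q"
    using assms by (intro add_mono frac_le) auto
  also have "\<dots> = (u powr q + v powr q) / (u + v) powr q"
    by (simp add: powr_divide add_divide_distrib)
  finally show ?thesis using s by (simp add: le_divide_eq)
qed

lemma powr_sum_le_sum_powr:
  fixes u :: "'i \<Rightarrow> real"
  assumes "\<And>i. 0 \<le> u i" "0 < q" "q \<le> 1"
  shows "sum u A powr q \<le> (\<Sum>i\<in>A. u i powr q)"
proof (induction A rule: infinite_finite_induct)
  case (insert x F)
  then show ?case
    using powr_add_le_add_powr[of "u x" "sum u F" q] assms by (simp add: sum_nonneg)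
qed auto

lemma one_add_le_two_powr:
  fixes p :: real
  assumes "1 \<le> p"
  shows "1 + p \<le> 2 powr p"
proof -
  have "2 powr p = 2 * 2 powr (p - 1)"
    using powr_add[of 2 1 "p - 1"] by simp
  also have "2 powr (p - 1) = exp ((p - 1) * ln 2)" by (simp add: powr_def)
  finally have "2 powr p = 2 * exp ((p - 1) * ln 2)" .
  moreover have "1 + (p - 1) * ln 2 \<le> exp ((p - 1) * ln 2)" by (rule exp_ge_add_one_self)
  moreover have "(p - 1) * (2 / 3) \<le> (p - 1) * ln 2"
    using ln2_ge_two_thirds assms by (intro mult_left_mono) auto
  ultimately show ?thesis using assms by argo
qed

lemma powr_diff_one_mult_le:
  fixes a b p :: real
  assumes "0 \<le> a" "0 \<le> b" "1 \<le> p"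
  shows "a powr (p - 1) * b \<le> a powr p + b powr p"
proof -
  have "a powr (p - 1) * b \<le> max a b powr (p - 1) * max a b"
    using assms by (intro mult_mono powr_mono2) auto
  also have "\<dots> = max a b powr p"
    using assms by (cases "max a b = 0") (simp_all add: powr_diff)
  also have "\<dots> \<le> a powr p + b powr p" by (simp add: max_def)
  finally show ?thesis .
qed

lemma powr_diff_two_mult_self:
  fixes a p :: real
  assumes "0 \<le> a"
  shows "a powr (p - 2) * a = a powr (p - 1)"
  using assms by (cases "a = 0") (simp_all add: powr_diff field_simps power2_eq_square)

lemma power2_powr:
  fixes z r :: real
  assumes "0 \<le> z"
  shows "(z\<^sup>2) powr r = z powr (2 * r)"
  using assms by (simp add: powr_powr[symmetric] powr_realpow)

(* The two cases of norm_add_powr_le, for a = norm x, b = norm y, c = x \<bullet> y, z = norm (x + y).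
   The first linearises the concave map w \<mapsto> w powr (p / 2) at w = 1. *)
lemma powr_expansion_le_dominant:
  fixes a b c z p :: real
  assumes ab: "0 < a" "0 \<le> b" "b \<le> a" and z: "0 \<le> z" "z\<^sup>2 = a\<^sup>2 + 2 * c + b\<^sup>2"
    and p: "1 < p" "p \<le> 2"
  shows "z powr p \<le> a powr p + p * a powr (p - 2) * c + b powr p"
proof -
  define q where "q = p / 2"
  define w where "w = z\<^sup>2 / a\<^sup>2"
  have q: "0 \<le> q" "q \<le> 1" using p by (auto simp: q_def)
  have "z powr p = (z\<^sup>2) powr q" using power2_powr[OF z(1), of q] by (simp add: q_def)
  also have "\<dots> = a powr p * w powr q"
    using ab by (simp add: w_def powr_divide power2_powr q_def)
  also have "w powr q \<le> q * w + (1 - q)"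
    using Youngs_inequality_0[of q "1 - q" w 1] q by (cases "w = 0") (auto simp: w_def)
  then have "a powr p * w powr q \<le> a powr p * (q * w + (1 - q))" by (rule mult_left_mono) simp
  also have "\<dots> = a powr p + q * (a powr p / a\<^sup>2) * (z\<^sup>2 - a\<^sup>2)"
    using ab by (simp add: w_def field_simps)
  also have "a powr p / a\<^sup>2 = a powr (p - 2)"
    using ab by (simp add: powr_diff power2_powr[of a 1, simplified])
  also have "q * a powr (p - 2) * (z\<^sup>2 - a\<^sup>2) = p * a powr (p - 2) * c + q * (a powr (p - 2) * b\<^sup>2)"
    unfolding z(2) q_def by (simp add: field_simps)
  also have "a powr (p - 2) * b\<^sup>2 \<le> b powr (p - 2) * b\<^sup>2"
    using ab p by (cases "b = 0") (auto intro!: mult_right_mono powr_mono2')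
  also have "b powr (p - 2) * b\<^sup>2 = b powr p"
    using ab by (cases "b = 0") (simp_all add: powr_diff power2_powr[of b 1, simplified])
  finally have "z powr p \<le> a powr p + p * a powr (p - 2) * c + q * b powr p"
    using q by (simp add: mult_left_mono)
  moreover have "q * b powr p \<le> b powr p" using q by (simp add: mult_left_le_one_le)
  ultimately show ?thesis by linarith
qed

lemma powr_expansion_le_small:
  fixes a b c z p :: real
  assumes ab: "0 \<le> a" "a \<le> b" and c: "\<bar>c\<bar> \<le> a * b"
    and z: "0 \<le> z" "z\<^sup>2 = a\<^sup>2 + 2 * c + b\<^sup>2" and p: "1 < p" "p \<le> 2"
  shows "z powr p \<le> a powr p + p * a powr (p - 2) * c + 2 powr p * b powr p"
proof (cases "0 \<le> c")
  case True
  have "z\<^sup>2 \<le> (a + b)\<^sup>2" using z c by (simp add: power2_sum)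
  also have "\<dots> \<le> (2 * b)\<^sup>2" using ab by (intro power_mono) auto
  finally have "z \<le> 2 * b" by (rule power2_le_imp_le) (use ab in simp)
  then have "z powr p \<le> 2 powr p * b powr p"
    using z p ab by (auto simp: powr_mult[symmetric] intro: powr_mono2)
  moreover have "0 \<le> p * a powr (p - 2) * c" using True p by simp
  moreover have "0 \<le> a powr p" by simp
  ultimately show ?thesis by linarith
next
  case False
  have "z powr p = (z\<^sup>2) powr (p / 2)" using power2_powr[OF z(1), of "p / 2"] by simp
  also have "\<dots> \<le> (a\<^sup>2 + b\<^sup>2) powr (p / 2)" using z(2)[symmetric] False p by (intro powr_mono2) auto
  also have "\<dots> \<le> (a\<^sup>2) powr (p / 2) + (b\<^sup>2) powr (p / 2)" using p by (intro powr_add_le_add_powr) auto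
  finally have zp: "z powr p \<le> a powr p + b powr p" using ab by (simp add: power2_powr)
  have "p * a powr (p - 2) * (- c) \<le> p * a powr (p - 2) * (a * b)"
    using c p by (intro mult_left_mono) auto
  then have "- (p * a powr (p - 2) * c) \<le> p * a powr (p - 2) * (a * b)" by simp
  also have "\<dots> = p * (a powr (p - 1) * b)" using ab by (simp add: powr_diff_two_mult_self[symmetric])
  also have "\<dots> \<le> p * (b powr (p - 1) * b)"
    using ab p by (intro mult_left_mono mult_right_mono powr_mono2) auto
  also have "\<dots> = p * b powr p"
    using ab powr_diff_two_mult_self[of b "p + 1"] by simp
  finally have "- (p * a powr (p - 2) * c) \<le> p * b powr p" .
  moreover have "(1 + p) * b powr p \<le> 2 powr p * b powr p"
    using one_add_le_two_powr p by (intro mult_right_mono) auto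
  ultimately show ?thesis using zp by (simp add: algebra_simps)
qed

lemma norm_add_powr_le:
  fixes x y :: "'a::real_inner" and p :: real
  assumes p: "1 < p" "p \<le> 2"
  shows "norm (x + y) powr p
    \<le> norm x powr p + p * norm x powr (p - 2) * (x \<bullet> y) + 2 powr p * norm y powr p"
proof -
  have z: "(norm (x + y))\<^sup>2 = (norm x)\<^sup>2 + 2 * (x \<bullet> y) + (norm y)\<^sup>2"
    by (simp add: power2_norm_eq_inner inner_add inner_commute)
  have c: "\<bar>x \<bullet> y\<bar> \<le> norm x * norm y" by (rule Cauchy_Schwarz_ineq2)
  show ?thesis
  proof (cases "0 < norm x \<and> norm y \<le> norm x")
    case True
    have "1 \<le> (2::real) powr p" using p by (intro ge_one_powr_ge_zero) auto
    then have "norm y powr p \<le> 2 powr p * norm y powr p"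
      using mult_right_mono[of 1 "2 powr p" "norm y powr p"] by simp
    moreover have "norm (x + y) powr p \<le> norm x powr p + p * norm x powr (p - 2) * (x \<bullet> y) + norm y powr p"
      using True by (intro powr_expansion_le_dominant[OF _ _ _ _ z p]) auto
    ultimately show ?thesis by linarith
  next
    case False
    then have "norm x \<le> norm y" by auto
    then show ?thesis by (intro powr_expansion_le_small[OF _ _ c _ z p]) auto
  qed
qed

lemma abs_powr_inner_mult_le:
  fixes u y e :: "'a::euclidean_space"
  assumes e: "e \<in> Basis" and p: "1 \<le> p"
  shows "\<bar>p * norm u powr (p - 2) * (u \<bullet> e) * (y \<bullet> e)\<bar> \<le> p * (norm u powr p + norm y powr p)"
proof -
  have "\<bar>p * norm u powr (p - 2) * (u \<bullet> e) * (y \<bullet> e)\<bar> = p * norm u powr (p - 2) * (\<bar>u \<bullet> e\<bar> * \<bar>y \<bullet> e\<bar>)"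
    using p by (simp add: abs_mult)
  also have "\<dots> \<le> p * norm u powr (p - 2) * (norm u * norm y)"
    using p e by (intro mult_left_mono mult_mono Basis_le_norm) auto
  also have "\<dots> = p * (norm u powr (p - 1) * norm y)"
    by (simp add: powr_diff_two_mult_self mult.assoc[symmetric])
  also have "\<dots> \<le> p * (norm u powr p + norm y powr p)"
    using p by (intro mult_left_mono powr_diff_one_mult_le) auto
  finally show ?thesis .
qed

lemma norm_add_powr_le_Basis:
  fixes u y :: "'a::euclidean_space"
  assumes p: "1 < p" "p \<le> 2"
  shows "norm (u + y) powr p \<le> norm u powr p
    + (\<Sum>e\<in>Basis. p * norm u powr (p - 2) * (u \<bullet> e) * (y \<bullet> e)) + 2 powr p * norm y powr p"
proof -
  have "p * norm u powr (p - 2) * (u \<bullet> y) = (\<Sum>e\<in>Basis. p * norm u powr (p - 2) * (u \<bullet> e) * (y \<bullet> e))"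
    by (simp add: euclidean_inner[of u y] sum_distrib_left mult.assoc)
  then show ?thesis using norm_add_powr_le[OF p, of u y] by simp
qed

lemma sum_powr_shift:
  fixes l p :: real
  shows "l powr p * (\<Sum>k<t. l powr (real (t - k) * p)) + l powr p = (\<Sum>k<Suc t. l powr (real (Suc t - k) * p))"
proof -
  have "l powr p * l powr (real (t - k) * p) = l powr (real (Suc t - k) * p)" if "k < t" for k
    using that by (simp add: powr_add[symmetric] Suc_diff_le of_nat_diff algebra_simps)
  then show ?thesis by (simp add: sum_distrib_left)
qed

lemma Youngs_inequality_scaled:
  fixes z c p :: real
  assumes "0 \<le> z" "0 < c" "1 < p"
  shows "z \<le> c powr (1 - p) * z powr p / p + c * (p - 1) / p"
proof -
  have "(z / c) * 1 \<le> (z / c) powr p / p + 1 powr (p / (p - 1)) / (p / (p - 1))"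
    using assms by (intro Youngs_inequality) (auto simp: field_simps)
  then have "c * (z / c) \<le> c * ((z / c) powr p / p + (p - 1) / p)"
    using assms by (intro mult_left_mono) auto
  moreover have "c * (z / c) powr p = c powr (1 - p) * z powr p"
    using assms by (simp add: powr_divide powr_diff)
  ultimately show ?thesis
    using assms by (simp add: distrib_left)
qed

section \<open>Stacked vectors and the mixing recursion\<close>

(* The Kronecker product A \<otimes> I acting on stacked vectors. *)
definition stack_mult :: "real^'n::finite^'n \<Rightarrow> ('d::real_vector)^'n \<Rightarrow> 'd^'n" where
  "stack_mult A z = (\<chi> i. \<Sum>r\<in>UNIV. A $ i $ r *\<^sub>R z $ r)"

lemma stack_mult_add: "stack_mult A (x + y) = stack_mult A x + stack_mult A y"
  by (simp add: stack_mult_def vec_eq_iff sum.distrib scaleR_add_right)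

lemma stack_mult_diff: "stack_mult A (x - y) = stack_mult A x - stack_mult A y"
  by (simp add: stack_mult_def vec_eq_iff sum_subtractf scaleR_diff_right)

lemma stack_mult_scaleR: "stack_mult A (c *\<^sub>R x) = c *\<^sub>R stack_mult A x"
  by (simp add: stack_mult_def vec_eq_iff scaleR_sum_right mult.commute)

lemma bounded_linear_stack_mult:
  "bounded_linear (stack_mult A :: ('d::euclidean_space)^'n::finite \<Rightarrow> _)"
  by (simp add: linear_conv_bounded_linear[symmetric] linearI stack_mult_add stack_mult_scaleR)

lemma borel_measurable_stack_mult [measurable]:
  fixes N :: "'a \<Rightarrow> ('d::euclidean_space)^'n::finite"
  assumes "N \<in> borel_measurable F"
  shows "(\<lambda>\<omega>. stack_mult A (N \<omega>)) \<in> borel_measurable F"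
  using borel_measurable_continuous_on[OF linear_continuous_on[OF bounded_linear_stack_mult] assms] .

lemma borel_measurable_vec_lambda [measurable]:
  fixes f :: "'a \<Rightarrow> 'n::finite \<Rightarrow> 'd::euclidean_space"
  assumes "\<And>i. (\<lambda>\<omega>. f \<omega> i) \<in> borel_measurable N"
  shows "(\<lambda>\<omega>. \<chi> i. f \<omega> i) \<in> borel_measurable N"
proof (subst borel_measurable_euclidean_space, intro ballI)
  fix e :: "'d^'n"
  assume "e \<in> Basis"
  then obtain i u where e: "e = axis i u" by (auto simp: Basis_vec_def)
  have [measurable]: "(\<lambda>\<omega>. f \<omega> i) \<in> borel_measurable N" by (rule assms)
  show "(\<lambda>\<omega>. (\<chi> i. f \<omega> i) \<bullet> e) \<in> borel_measurable N" by (simp add: e inner_axis)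
qed

lemma borel_measurable_lipschitz:
  fixes f :: "'d::euclidean_space \<Rightarrow> 'e::euclidean_space"
  assumes "\<And>x y. norm (f x - f y) \<le> L * norm (x - y)"
  shows "f \<in> borel_measurable borel"
proof (rule borel_measurable_continuous_onI, rule lipschitz_on_continuous_on)
  show "\<bar>L\<bar>-lipschitz_on UNIV f"
  proof (rule lipschitz_onI)
    fix x y :: 'd
    have "L * norm (x - y) \<le> \<bar>L\<bar> * norm (x - y)" by (intro mult_right_mono) auto
    then show "dist (f x) (f y) \<le> \<bar>L\<bar> * dist x y" using assms[of x y] by (simp add: dist_norm)
  qed simp
qed

lemma norm_stack_mult_le:
  fixes z :: "('d::euclidean_space)^'n::finite"
  shows "norm (stack_mult A z) \<le> onorm ((*v) A) * norm z"
proof -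
  define l where "l = onorm ((*v) A)"
  define zb where "zb b = (\<chi> r. z $ r \<bullet> b)" for b
  have norm2_vec: "(norm u)\<^sup>2 = (\<Sum>i\<in>UNIV. (norm (u $ i))\<^sup>2)" for u :: "'e::real_inner^'n"
    by (simp add: power2_norm_eq_inner inner_vec_def)
  have norm2_eucl: "(norm e)\<^sup>2 = (\<Sum>b\<in>Basis. (e \<bullet> b)\<^sup>2)" for e :: 'd
    unfolding power2_norm_eq_inner euclidean_inner[of e e] by (simp add: power2_eq_square)
  have "(norm (stack_mult A z))\<^sup>2 = (\<Sum>i\<in>UNIV. \<Sum>b\<in>Basis. ((stack_mult A z) $ i \<bullet> b)\<^sup>2)"
    by (simp add: norm2_vec norm2_eucl)
  also have "\<dots> = (\<Sum>b\<in>Basis. \<Sum>i\<in>UNIV. ((A *v zb b) $ i)\<^sup>2)"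
    by (subst sum.swap) (simp add: stack_mult_def matrix_vector_mult_def zb_def inner_sum_left)
  also have "\<dots> = (\<Sum>b\<in>Basis. (norm (A *v zb b))\<^sup>2)"
    by (simp add: norm2_vec)
  also have "\<dots> \<le> (\<Sum>b\<in>Basis. (l * norm (zb b))\<^sup>2)"
    unfolding l_def by (intro sum_mono power_mono onorm) simp_all
  also have "\<dots> = l\<^sup>2 * (\<Sum>b\<in>Basis. \<Sum>r\<in>UNIV. (z $ r \<bullet> b)\<^sup>2)"
    by (simp add: power_mult_distrib sum_distrib_left norm2_vec zb_def)
  also have "\<dots> = (l * norm z)\<^sup>2"
    by (subst sum.swap) (simp add: norm2_vec norm2_eucl power_mult_distrib)
  finally show ?thesis
    using onorm_pos_le[of "(*v) A"] by (simp add: l_def power2_le_iff_abs_le)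
qed

lemma norm_stack_mult_powr_le:
  fixes z :: "('d::euclidean_space)^'n::finite"
  assumes "0 \<le> p"
  shows "norm (stack_mult A z) powr p \<le> onorm ((*v) A) powr p * norm z powr p"
proof -
  have "norm (stack_mult A z) powr p \<le> (onorm ((*v) A) * norm z) powr p"
    using assms by (intro powr_mono2 norm_stack_mult_le) auto
  then show ?thesis by (simp add: powr_mult)
qed

lemma norm_vec_lambda_powr_le:
  fixes f :: "'n::finite \<Rightarrow> 'd::real_inner"
  assumes "0 < p" "p \<le> 2"
  shows "norm (\<chi> i. f i) powr p \<le> (\<Sum>i\<in>UNIV. norm (f i) powr p)"
proof -
  have "norm (\<chi> i. f i) powr p = (\<Sum>i\<in>UNIV. (norm (f i))\<^sup>2) powr (p / 2)"
    using power2_powr[of "norm (\<chi> i. f i)" "p / 2"]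
    by (simp add: power2_norm_eq_inner inner_vec_def)
  also have "\<dots> \<le> (\<Sum>i\<in>UNIV. ((norm (f i))\<^sup>2) powr (p / 2))"
    using assms by (intro powr_sum_le_sum_powr) auto
  also have "\<dots> = (\<Sum>i\<in>UNIV. norm (f i) powr p)" by (simp add: power2_powr)
  finally show ?thesis .
qed

lemma norm_vec_le_sum_norm: "norm (z :: ('d::real_normed_vector)^'n::finite) \<le> (\<Sum>i\<in>UNIV. norm (z $ i))"
  by (simp add: norm_vec_def L2_set_le_sum)

lemma sum_norm_le_sqrt_card_mult_norm:
  fixes z :: "('d::real_inner)^'n::finite"
  shows "(\<Sum>i\<in>UNIV. norm (z $ i)) \<le> sqrt (real CARD('n)) * norm z"
proof -
  have "(\<Sum>i\<in>UNIV. 1 * norm (z $ i))\<^sup>2 \<le> (\<Sum>i\<in>(UNIV::'n set). 1\<^sup>2) * (\<Sum>i\<in>UNIV. (norm (z $ i))\<^sup>2)"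
    by (rule Cauchy_Schwarz_ineq_sum)
  also have "\<dots> = (sqrt (real CARD('n)) * norm z)\<^sup>2"
    by (simp add: power_mult_distrib power2_norm_eq_inner inner_vec_def)
  finally have "(\<Sum>i\<in>UNIV. norm (z $ i))\<^sup>2 \<le> (sqrt (real CARD('n)) * norm z)\<^sup>2" by simp
  then show ?thesis by (rule power2_le_imp_le) simp
qed

lemma stack_norm_eq_norm: "stack_norm z = norm (\<chi> i. z i)"
  by (simp add: stack_norm_def norm_vec_def L2_set_def)

definition mean_dev :: "('n::finite \<Rightarrow> 'd::real_vector) \<Rightarrow> 'd^'n" where
  "mean_dev y = (\<chi> i. y i - (1 / real CARD('n)) *\<^sub>R (\<Sum>r\<in>UNIV. y r))"

definition centered_matrix :: "real^'n::finite^'n \<Rightarrow> real^'n^'n" where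
  "centered_matrix W = (\<chi> i j. W $ i $ j - 1 / real CARD('n))"

lemma mix_lambda_eq_onorm: "mix_lambda W = onorm ((*v) (centered_matrix W))"
  by (simp add: mix_lambda_def centered_matrix_def)

lemma mean_dev_mix:
  fixes W :: "real^'n::finite^'n" and u :: "'n \<Rightarrow> 'd::real_vector"
  assumes "doubly_stochastic W"
  shows "mean_dev (\<lambda>i. \<Sum>r\<in>UNIV. W $ i $ r *\<^sub>R u r) = stack_mult (centered_matrix W) (mean_dev u)"
proof -
  define c where "c = 1 / real CARD('n)"
  define m where "m = c *\<^sub>R (\<Sum>r\<in>UNIV. u r)"
  have rows: "(\<Sum>r\<in>UNIV. W $ i $ r) = 1" and cols: "(\<Sum>i\<in>UNIV. W $ i $ r) = 1" for i r
    using assms by (simp_all add: doubly_stochastic_def)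
  have mean: "c *\<^sub>R (\<Sum>i\<in>UNIV. \<Sum>r\<in>UNIV. W $ i $ r *\<^sub>R u r) = m"
    unfolding m_def by (subst sum.swap) (simp add: scaleR_sum_left[symmetric] cols)
  have centered: "(\<Sum>r\<in>UNIV. c *\<^sub>R (u r - m)) = 0"
    by (simp add: m_def c_def scaleR_sum_right[symmetric] sum_subtractf sum_constant_scaleR)
  have split: "(\<Sum>r\<in>UNIV. (W $ i $ r - c) *\<^sub>R (u r - m))
      = (\<Sum>r\<in>UNIV. W $ i $ r *\<^sub>R u r) - (\<Sum>r\<in>UNIV. W $ i $ r) *\<^sub>R m
        - (\<Sum>r\<in>UNIV. c *\<^sub>R (u r - m))" for i
    by (simp add: scaleR_diff_left scaleR_diff_right sum_subtractf scaleR_sum_left)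
  show ?thesis
    unfolding mean_dev_def stack_mult_def centered_matrix_def c_def[symmetric] m_def[symmetric] mean
    by (simp add: vec_eq_iff split rows centered)
qed

lemma stack_mult_centered_mean_dev:
  fixes W :: "real^'n::finite^'n" and u :: "'n \<Rightarrow> 'd::real_vector"
  assumes "doubly_stochastic W"
  shows "stack_mult (centered_matrix W) (mean_dev u) = stack_mult (centered_matrix W) (\<chi> i. u i)"
proof -
  define m where "m = (1 / real CARD('n)) *\<^sub>R (\<Sum>r\<in>UNIV. u r)"
  have "(\<Sum>r\<in>UNIV. W $ i $ r - 1 / real CARD('n)) = 0" for i
    using assms by (simp add: doubly_stochastic_def sum_subtractf)
  then have "stack_mult (centered_matrix W) (\<chi> i. m) = 0"
    by (simp add: stack_mult_def centered_matrix_def vec_eq_iff scaleR_sum_left[symmetric])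
  moreover have "mean_dev u = (\<chi> i. u i) - (\<chi> i. m)" by (simp add: mean_dev_def m_def vec_eq_iff)
  ultimately show ?thesis by (simp add: stack_mult_diff)
qed

(* mixing_rec A E t = (\<Sum>k<t. (A^(t - k) \<otimes> I) (E k)) *)
fun mixing_rec :: "real^'n::finite^'n \<Rightarrow> (nat \<Rightarrow> ('d::real_vector)^'n) \<Rightarrow> nat \<Rightarrow> 'd^'n" where
  "mixing_rec A E 0 = 0"
| "mixing_rec A E (Suc t) = stack_mult A (mixing_rec A E t + E t)"

lemma mixing_rec_add: "mixing_rec A (\<lambda>k. E k + D k) t = mixing_rec A E t + mixing_rec A D t"
  by (induction t) (simp_all add: stack_mult_add[symmetric] algebra_simps)

lemma norm_mixing_rec_le:
  fixes E :: "nat \<Rightarrow> ('d::euclidean_space)^'n::finite"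
  shows "norm (mixing_rec A E t) \<le> (\<Sum>k<t. onorm ((*v) A) ^ (t - k) * norm (E k))"
proof (induction t)
  case (Suc t)
  define l where "l = onorm ((*v) A)"
  have l: "0 \<le> l" unfolding l_def by (rule onorm_pos_le) simp
  have "norm (mixing_rec A E (Suc t)) \<le> l * norm (mixing_rec A E t + E t)"
    unfolding l_def by (simp add: norm_stack_mult_le)
  also have "\<dots> \<le> l * ((\<Sum>k<t. l ^ (t - k) * norm (E k)) + norm (E t))"
    using Suc l by (intro mult_left_mono order.trans[OF norm_triangle_ineq]) (auto simp: l_def)
  also have "\<dots> = (\<Sum>k<Suc t. l ^ (Suc t - k) * norm (E k))"
    by (simp add: sum_distrib_left algebra_simps Suc_diff_le)
  finally show ?case by (simp add: l_def)
qed simp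

lemma borel_measurable_mixing_rec:
  fixes E :: "nat \<Rightarrow> 'a \<Rightarrow> ('d::euclidean_space)^'n::finite"
  assumes "\<And>k. k < t \<Longrightarrow> E k \<in> borel_measurable N"
  shows "(\<lambda>\<omega>. mixing_rec A (\<lambda>k. E k \<omega>) t) \<in> borel_measurable N"
  using assms by (induction t) (simp_all add: borel_measurable_stack_mult)

section \<open>Moment bounds\<close>

context prob_space
begin

lemma sigma_finite_subalgebra_of_subalgebra:
  assumes "subalgebra M F"
  shows "sigma_finite_subalgebra M F"
  using assms finite_measure_axioms
  by (intro finite_measure_subalgebra_is_sigma_finite)
    (simp add: finite_measure_subalgebra_def finite_measure_subalgebra_axioms_def)

lemma integral_mult_eq_zero_of_cond_exp_zero:
  fixes Y H :: "'a \<Rightarrow> real"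
  assumes sub: "subalgebra M F" and ce: "AE \<omega> in M. real_cond_exp M F Y \<omega> = 0"
    and [measurable]: "Y \<in> borel_measurable M" "H \<in> borel_measurable F"
    and int: "integrable M (\<lambda>\<omega>. H \<omega> * Y \<omega>)"
  shows "(\<integral>\<omega>. H \<omega> * Y \<omega> \<partial>M) = 0"
proof -
  interpret sigma_finite_subalgebra M F by (rule sigma_finite_subalgebra_of_subalgebra[OF sub])
  have "(\<integral>\<omega>. H \<omega> * Y \<omega> \<partial>M) = (\<integral>\<omega>. H \<omega> * real_cond_exp M F Y \<omega> \<partial>M)"
    using real_cond_exp_intg(2)[OF int] by simp
  also have "\<dots> = 0"
    using ce by (intro integral_eq_zero_AE) auto
  finally show ?thesis .
qed

lemma integral_le_of_nn_cond_exp_le: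
  fixes Y :: "'a \<Rightarrow> real"
  assumes sub: "subalgebra M F"
    and ce: "AE \<omega> in M. nn_cond_exp M F (\<lambda>\<omega>. ennreal (Y \<omega>)) \<omega> \<le> ennreal c"
    and [measurable]: "Y \<in> borel_measurable M" and Y: "\<And>\<omega>. 0 \<le> Y \<omega>" and c: "0 \<le> c"
  shows "integrable M Y" "(\<integral>\<omega>. Y \<omega> \<partial>M) \<le> c"
proof -
  interpret sigma_finite_subalgebra M F by (rule sigma_finite_subalgebra_of_subalgebra[OF sub])
  have "(\<integral>\<^sup>+\<omega>. ennreal (Y \<omega>) \<partial>M) = (\<integral>\<^sup>+\<omega>. 1 * nn_cond_exp M F (\<lambda>\<omega>. ennreal (Y \<omega>)) \<omega> \<partial>M)"
    using nn_cond_exp_intg[of "\<lambda>_. 1" "\<lambda>\<omega>. ennreal (Y \<omega>)"] by simp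
  also have "\<dots> \<le> (\<integral>\<^sup>+\<omega>. ennreal c \<partial>M)"
    using ce by (intro nn_integral_mono_AE) auto
  finally have le: "(\<integral>\<^sup>+\<omega>. ennreal (Y \<omega>) \<partial>M) \<le> ennreal c" by (simp add: emeasure_space_1)
  then show int: "integrable M Y"
    using Y by (intro integrableI_nonneg) (auto simp: top_unique intro: le_less_trans)
  show "(\<integral>\<omega>. Y \<omega> \<partial>M) \<le> c"
    using le nn_integral_eq_integral[OF int] Y c by simp
qed

lemma integrable_of_integrable_powr:
  fixes Z :: "'a \<Rightarrow> real"
  assumes p: "1 \<le> p" and [measurable]: "Z \<in> borel_measurable M"
    and Z: "\<And>\<omega>. 0 \<le> Z \<omega>" and int: "integrable M (\<lambda>\<omega>. Z \<omega> powr p)"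
  shows "integrable M Z"
proof (rule Bochner_Integration.integrable_bound[of _ "\<lambda>\<omega>. 1 + Z \<omega> powr p"])
  show "integrable M (\<lambda>\<omega>. 1 + Z \<omega> powr p)" using int by simp
  have "Z \<omega> \<le> 1 + Z \<omega> powr p" for \<omega>
    using p powr_mono[of 1 p "Z \<omega>"] by (cases "Z \<omega> \<le> 1") (auto intro: add_increasing2)
  then show "AE \<omega> in M. norm (Z \<omega>) \<le> norm (1 + Z \<omega> powr p)" using Z by simp
qed simp

(* Integrate Youngs_inequality_scaled and choose c = (E Z^p)^(1/p). *)
lemma integral_le_integral_powr_root:
  fixes Z :: "'a \<Rightarrow> real"
  assumes p: "1 < p" and Zm: "Z \<in> borel_measurable M"
    and Z: "\<And>\<omega>. 0 \<le> Z \<omega>" and int: "integrable M (\<lambda>\<omega>. Z \<omega> powr p)"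
  shows "(\<integral>\<omega>. Z \<omega> \<partial>M) \<le> (\<integral>\<omega>. Z \<omega> powr p \<partial>M) powr (1 / p)"
proof -
  define B where "B = (\<integral>\<omega>. Z \<omega> powr p \<partial>M)"
  have B: "0 \<le> B" unfolding B_def by (simp add: integral_nonneg_AE)
  have Zint: "integrable M Z" using integrable_of_integrable_powr[OF _ Zm Z int] p by simp
  have bound: "(\<integral>\<omega>. Z \<omega> \<partial>M) \<le> c powr (1 - p) * B / p + c * (p - 1) / p" if c: "0 < c" for c
  proof -
    have "(\<integral>\<omega>. Z \<omega> \<partial>M) \<le> (\<integral>\<omega>. c powr (1 - p) * Z \<omega> powr p / p + c * (p - 1) / p \<partial>M)"
      using Zint int Youngs_inequality_scaled[OF Z c p] by (intro integral_mono) auto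
    then show ?thesis using int by (simp add: B_def prob_space)
  qed
  show ?thesis
  proof (cases "B = 0")
    case True
    have "(\<integral>\<omega>. Z \<omega> \<partial>M) \<le> 0 + e" if e: "0 < e" for e
    proof -
      have "(\<integral>\<omega>. Z \<omega> \<partial>M) \<le> e * (p - 1) / p" using bound[OF e] True by simp
      also have "\<dots> \<le> 0 + e" using p e by (simp add: field_simps)
      finally show ?thesis .
    qed
    then have "(\<integral>\<omega>. Z \<omega> \<partial>M) \<le> 0" by (rule field_le_epsilon)
    then show ?thesis using True by (simp add: B_def[symmetric])
  next
    case False
    define c where "c = B powr (1 / p)"
    have c: "0 < c" using False B by (simp add: c_def)
    have cp: "c powr p = B" using B p by (simp add: c_def powr_powr)
    have "c powr (1 - p) * B = c" using c by (simp add: cp[symmetric] powr_add[symmetric])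
    then have "(\<integral>\<omega>. Z \<omega> \<partial>M) \<le> c / p + c * (p - 1) / p"
      using bound[OF c] by simp
    also have "\<dots> = c" using p by (simp add: field_simps)
    finally show ?thesis by (simp add: c_def B_def[symmetric])
  qed
qed

(* The cross term of norm_add_powr_le has mean zero: U is F-measurable and Y has conditional
   mean zero given F. *)
lemma integral_norm_add_powr_le:
  fixes U Y :: "'a \<Rightarrow> 'v::euclidean_space"
  assumes p: "1 < p" "p \<le> 2" and sub: "subalgebra M F"
    and [measurable]: "U \<in> borel_measurable F" "Y \<in> borel_measurable M"
    and Uint: "integrable M (\<lambda>\<omega>. norm (U \<omega>) powr p)"
    and Yint: "integrable M (\<lambda>\<omega>. norm (Y \<omega>) powr p)"
    and ce: "\<And>e. e \<in> Basis \<Longrightarrow> AE \<omega> in M. real_cond_exp M F (\<lambda>\<omega>. Y \<omega> \<bullet> e) \<omega> = 0"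
  shows "integrable M (\<lambda>\<omega>. norm (U \<omega> + Y \<omega>) powr p)"
    and "(\<integral>\<omega>. norm (U \<omega> + Y \<omega>) powr p \<partial>M)
      \<le> (\<integral>\<omega>. norm (U \<omega>) powr p \<partial>M) + 2 powr p * (\<integral>\<omega>. norm (Y \<omega>) powr p \<partial>M)"
proof -
  define H where "H e \<omega> = p * norm (U \<omega>) powr (p - 2) * (U \<omega> \<bullet> e)" for e \<omega>
  have [measurable]: "U \<in> borel_measurable M" by (rule measurable_from_subalg[OF sub]) simp
  have HF: "H e \<in> borel_measurable F" for e unfolding H_def by measurable
  have [measurable]: "H e \<in> borel_measurable M" for e by (rule measurable_from_subalg[OF sub HF])
  have Hbd: "\<bar>H e \<omega> * (Y \<omega> \<bullet> e)\<bar> \<le> p * (norm (U \<omega>) powr p + norm (Y \<omega>) powr p)"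
    if e: "e \<in> Basis" for e \<omega>
    unfolding H_def using abs_powr_inner_mult_le[OF e, of p] p by simp
  have Hint: "integrable M (\<lambda>\<omega>. H e \<omega> * (Y \<omega> \<bullet> e))" if e: "e \<in> Basis" for e
    by (rule Bochner_Integration.integrable_bound
        [of _ "\<lambda>\<omega>. p * (norm (U \<omega>) powr p + norm (Y \<omega>) powr p)"])
      (use Uint Yint order_trans[OF Hbd[OF e] abs_ge_self] in auto)
  have Hzero: "(\<integral>\<omega>. H e \<omega> * (Y \<omega> \<bullet> e) \<partial>M) = 0" if e: "e \<in> Basis" for e
    by (rule integral_mult_eq_zero_of_cond_exp_zero[OF sub ce[OF e] _ HF Hint[OF e]]) simp
  define R where "R \<omega> = norm (U \<omega>) powr p + (\<Sum>e\<in>Basis. H e \<omega> * (Y \<omega> \<bullet> e))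
    + 2 powr p * norm (Y \<omega>) powr p" for \<omega>
  have pointwise: "norm (U \<omega> + Y \<omega>) powr p \<le> R \<omega>" for \<omega>
    unfolding R_def H_def by (rule norm_add_powr_le_Basis[OF p])
  have Rint: "integrable M R"
    unfolding R_def using Uint Yint Hint by (intro Bochner_Integration.integrable_add) auto
  show int: "integrable M (\<lambda>\<omega>. norm (U \<omega> + Y \<omega>) powr p)"
    by (rule Bochner_Integration.integrable_bound[OF Rint])
      (use pointwise in \<open>auto intro: order_trans[OF _ abs_ge_self]\<close>)
  have "(\<integral>\<omega>. norm (U \<omega> + Y \<omega>) powr p \<partial>M) \<le> (\<integral>\<omega>. R \<omega> \<partial>M)"
    by (rule integral_mono[OF int Rint pointwise])
  also have "(\<integral>\<omega>. R \<omega> \<partial>M)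
      = (\<integral>\<omega>. norm (U \<omega>) powr p \<partial>M) + 2 powr p * (\<integral>\<omega>. norm (Y \<omega>) powr p \<partial>M)"
    unfolding R_def using Uint Yint Hint Hzero by (simp add: Bochner_Integration.integral_sum)
  finally show "(\<integral>\<omega>. norm (U \<omega> + Y \<omega>) powr p \<partial>M)
      \<le> (\<integral>\<omega>. norm (U \<omega>) powr p \<partial>M) + 2 powr p * (\<integral>\<omega>. norm (Y \<omega>) powr p \<partial>M)" .
qed

lemma integral_norm_stack_mult_add_powr_le:
  fixes U Y :: "'a \<Rightarrow> ('d::euclidean_space)^'n::finite"
  assumes p: "1 < p" "p \<le> 2" and sub: "subalgebra M F"
    and U: "U \<in> borel_measurable F" and Y: "Y \<in> borel_measurable M"
    and Uint: "integrable M (\<lambda>\<omega>. norm (U \<omega>) powr p)"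
    and Yint: "integrable M (\<lambda>\<omega>. norm (Y \<omega>) powr p)"
    and ce: "\<And>e. e \<in> Basis \<Longrightarrow> AE \<omega> in M. real_cond_exp M F (\<lambda>\<omega>. Y \<omega> \<bullet> e) \<omega> = 0"
  shows "integrable M (\<lambda>\<omega>. norm (stack_mult A (U \<omega> + Y \<omega>)) powr p)"
    and "(\<integral>\<omega>. norm (stack_mult A (U \<omega> + Y \<omega>)) powr p \<partial>M) \<le> onorm ((*v) A) powr p
      * ((\<integral>\<omega>. norm (U \<omega>) powr p \<partial>M) + 2 powr p * (\<integral>\<omega>. norm (Y \<omega>) powr p \<partial>M))"
proof -
  note sum = integral_norm_add_powr_le[OF p sub U Y Uint Yint ce]
  have [measurable]: "U \<in> borel_measurable M" by (rule measurable_from_subalg[OF sub U])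
  have [measurable]: "Y \<in> borel_measurable M" by (rule Y)
  have pointwise: "norm (stack_mult A (U \<omega> + Y \<omega>)) powr p \<le> onorm ((*v) A) powr p * norm (U \<omega> + Y \<omega>) powr p"
    for \<omega> using p by (intro norm_stack_mult_powr_le) auto
  have bound_int: "integrable M (\<lambda>\<omega>. onorm ((*v) A) powr p * norm (U \<omega> + Y \<omega>) powr p)"
    using sum(1) by simp
  show int: "integrable M (\<lambda>\<omega>. norm (stack_mult A (U \<omega> + Y \<omega>)) powr p)"
    by (rule Bochner_Integration.integrable_bound[OF bound_int])
      (use pointwise in \<open>auto intro: order_trans[OF _ abs_ge_self]\<close>)
  have "(\<integral>\<omega>. norm (stack_mult A (U \<omega> + Y \<omega>)) powr p \<partial>M)
      \<le> onorm ((*v) A) powr p * (\<integral>\<omega>. norm (U \<omega> + Y \<omega>) powr p \<partial>M)"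
    using integral_mono[OF int bound_int pointwise] by simp
  also have "\<dots> \<le> onorm ((*v) A) powr p
      * ((\<integral>\<omega>. norm (U \<omega>) powr p \<partial>M) + 2 powr p * (\<integral>\<omega>. norm (Y \<omega>) powr p \<partial>M))"
    using sum(2) by (intro mult_left_mono) auto
  finally show "(\<integral>\<omega>. norm (stack_mult A (U \<omega> + Y \<omega>)) powr p \<partial>M) \<le> onorm ((*v) A) powr p
      * ((\<integral>\<omega>. norm (U \<omega>) powr p \<partial>M) + 2 powr p * (\<integral>\<omega>. norm (Y \<omega>) powr p \<partial>M))" .
qed

lemma mixing_rec_moment_le:
  fixes E :: "nat \<Rightarrow> 'a \<Rightarrow> ('d::euclidean_space)^'n::finite" and A :: "real^'n^'n"
  assumes p: "1 < p" "p \<le> 2" and sub: "\<And>k. subalgebra M (F k)"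
    and meas: "\<And>j k. j < k \<Longrightarrow> E j \<in> borel_measurable (F k)"
    and int: "\<And>k. integrable M (\<lambda>\<omega>. norm (E k \<omega>) powr p)"
    and bnd: "\<And>k. (\<integral>\<omega>. norm (E k \<omega>) powr p \<partial>M) \<le> m"
    and ce: "\<And>k e. e \<in> Basis \<Longrightarrow> AE \<omega> in M. real_cond_exp M (F k) (\<lambda>\<omega>. E k \<omega> \<bullet> e) \<omega> = 0"
  shows "integrable M (\<lambda>\<omega>. norm (mixing_rec A (\<lambda>k. E k \<omega>) t) powr p) \<and>
    (\<integral>\<omega>. norm (mixing_rec A (\<lambda>k. E k \<omega>) t) powr p \<partial>M)
      \<le> 2 powr p * m * (\<Sum>k<t. onorm ((*v) A) powr (real (t - k) * p))"
proof (induction t)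
  case (Suc t)
  define l where "l = onorm ((*v) A)"
  define N where "N \<omega> = mixing_rec A (\<lambda>k. E k \<omega>) t" for \<omega>
  have EM: "E t \<in> borel_measurable M"
    using measurable_from_subalg[OF sub meas[of t "Suc t"]] by simp
  have NF: "N \<in> borel_measurable (F t)"
    unfolding N_def by (intro borel_measurable_mixing_rec meas)
  have Nint: "integrable M (\<lambda>\<omega>. norm (N \<omega>) powr p)" using Suc.IH by (simp add: N_def)
  note step = integral_norm_stack_mult_add_powr_le[OF p sub NF EM Nint int ce, of A]
  have "2 powr p * (\<integral>\<omega>. norm (E t \<omega>) powr p \<partial>M) \<le> 2 powr p * m"
    using bnd[of t] by (intro mult_left_mono) auto
  then have "(\<integral>\<omega>. norm (N \<omega>) powr p \<partial>M) + 2 powr p * (\<integral>\<omega>. norm (E t \<omega>) powr p \<partial>M)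
      \<le> 2 powr p * m * (\<Sum>k<t. l powr (real (t - k) * p)) + 2 powr p * m"
    using Suc.IH unfolding N_def l_def by linarith
  then have "l powr p * ((\<integral>\<omega>. norm (N \<omega>) powr p \<partial>M) + 2 powr p * (\<integral>\<omega>. norm (E t \<omega>) powr p \<partial>M))
      \<le> l powr p * (2 powr p * m * (\<Sum>k<t. l powr (real (t - k) * p)) + 2 powr p * m)"
    by (rule mult_left_mono) simp
  with step(2) have "(\<integral>\<omega>. norm (mixing_rec A (\<lambda>k. E k \<omega>) (Suc t)) powr p \<partial>M)
      \<le> l powr p * (2 powr p * m * (\<Sum>k<t. l powr (real (t - k) * p)) + 2 powr p * m)"
    by (simp add: N_def l_def)
  also have "\<dots> = 2 powr p * m * (\<Sum>k<Suc t. l powr (real (Suc t - k) * p))"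
    unfolding sum_powr_shift[symmetric] by (simp add: algebra_simps)
  finally show ?case using step(1) by (simp add: N_def l_def)
qed simp

end

section \<open>The GT-NSGDm iteration\<close>

lemma subalgebra_nat_filtr:
  assumes "\<And>i k. \<xi> i k \<in> M \<rightarrow>\<^sub>M S"
  shows "subalgebra M (nat_filtr M S \<xi> t)"
proof -
  have "{\<xi> i k -` A \<inter> space M | i k A. k < t \<and> A \<in> sets S} \<subseteq> sets M"
    using assms by (auto simp: measurable_def)
  then show ?thesis
    unfolding subalgebra_def nat_filtr_def
    by (simp add: space_measure_of_conv sets_measure_of_conv sets.sigma_sets_subset sets.sets_into_space)
qed

lemma measurable_nat_filtr:
  assumes "\<And>i k. \<xi> i k \<in> M \<rightarrow>\<^sub>M S" and "j < t"
  shows "\<xi> i j \<in> nat_filtr M S \<xi> t \<rightarrow>\<^sub>M S"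
proof -
  have gen: "{\<xi> i k -` A \<inter> space M | i k A. k < t \<and> A \<in> sets S} \<subseteq> Pow (space M)" by auto
  show ?thesis
  proof (rule measurableI)
    show "\<xi> i j x \<in> space S" if "x \<in> space (nat_filtr M S \<xi> t)" for x
      using that measurable_space[OF assms(1)] by (simp add: nat_filtr_def space_measure_of_conv)
    show "\<xi> i j -` A \<inter> space (nat_filtr M S \<xi> t) \<in> sets (nat_filtr M S \<xi> t)" if "A \<in> sets S" for A
      using that assms(2) unfolding nat_filtr_def sets_measure_of[OF gen]
      by (auto simp: space_measure_of_conv intro!: sigma_sets.Basic)
  qed
qed

lemma gt_v_0: "gt_v W \<alpha> \<beta> g x0 s 0 i = (1 - \<beta>) *\<^sub>R g i x0 (s i 0)"
  by (simp add: gt_v_def gt_step_def Let_def)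

lemma gt_v_Suc: "gt_v W \<alpha> \<beta> g x0 s (Suc k) i
    = \<beta> *\<^sub>R gt_v W \<alpha> \<beta> g x0 s k i + (1 - \<beta>) *\<^sub>R g i (gt_x W \<alpha> \<beta> g x0 s (Suc k) i) (s i (Suc k))"
  by (simp add: gt_v_def gt_x_def gt_step_def Let_def)

lemma borel_measurable_gt_state:
  fixes g :: "'n::finite \<Rightarrow> 'd::euclidean_space \<Rightarrow> 's \<Rightarrow> 'd"
  assumes [measurable]: "\<And>i. (\<lambda>(x, s). g i x s) \<in> borel \<Otimes>\<^sub>M S \<rightarrow>\<^sub>M borel"
    and "\<And>i k. k < t \<Longrightarrow> \<xi> i k \<in> N \<rightarrow>\<^sub>M S"
  shows "(\<lambda>\<omega>. fst (gt_state W \<alpha> \<beta> g x0 (\<lambda>j k. \<xi> j k \<omega>) t) i) \<in> borel_measurable N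
    \<and> (\<lambda>\<omega>. fst (snd (gt_state W \<alpha> \<beta> g x0 (\<lambda>j k. \<xi> j k \<omega>) t)) i) \<in> borel_measurable N
    \<and> (\<lambda>\<omega>. snd (snd (gt_state W \<alpha> \<beta> g x0 (\<lambda>j k. \<xi> j k \<omega>) t)) i) \<in> borel_measurable N"
  using assms(2)
proof (induction t arbitrary: i)
  case (Suc t)
  have [measurable]: "\<xi> j t \<in> N \<rightarrow>\<^sub>M S" for j using Suc.prems by simp
  have [measurable]:
      "(\<lambda>\<omega>. fst (gt_state W \<alpha> \<beta> g x0 (\<lambda>j k. \<xi> j k \<omega>) t) j) \<in> borel_measurable N"
      "(\<lambda>\<omega>. fst (snd (gt_state W \<alpha> \<beta> g x0 (\<lambda>j k. \<xi> j k \<omega>) t)) j) \<in> borel_measurable N"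
      "(\<lambda>\<omega>. snd (snd (gt_state W \<alpha> \<beta> g x0 (\<lambda>j k. \<xi> j k \<omega>) t)) j) \<in> borel_measurable N" for j
    using Suc by auto
  show ?case by (simp add: gt_step_def Let_def) measurable
qed simp

(* Each update is a convex combination of points moved by at most \<alpha>: the normalised directions
   have norm at most 1 (they are 0 where y = 0, as 1 / 0 = 0). *)
lemma norm_gt_x_diff_le:
  assumes W: "doubly_stochastic W" and \<alpha>: "0 \<le> \<alpha>"
  shows "norm (gt_x W \<alpha> \<beta> g x0 s t i - x0) \<le> \<alpha> * real t"
proof (induction t arbitrary: i)
  case (Suc t)
  define st where "st = gt_state W \<alpha> \<beta> g x0 s t"
  define y where "y = snd (snd (gt_step W \<alpha> \<beta> g (\<lambda>i. s i t) st))"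
  define u where "u r = (1 / norm (y r)) *\<^sub>R y r" for r
  have u: "norm (u r) \<le> 1" for r by (cases "y r = 0") (auto simp: u_def)
  have rows: "(\<Sum>r\<in>UNIV. W $ i $ r) = 1" and nonneg: "0 \<le> W $ i $ r" for r
    using W by (simp_all add: doubly_stochastic_def)
  have "gt_x W \<alpha> \<beta> g x0 s (Suc t) i - x0 = (\<Sum>r\<in>UNIV. W $ i $ r *\<^sub>R ((fst st r - x0) - \<alpha> *\<^sub>R u r))"
    by (simp add: gt_x_def st_def y_def u_def gt_step_def Let_def scaleR_diff_right sum_subtractf
        scaleR_sum_left[symmetric] rows)
  also have "norm \<dots> \<le> (\<Sum>r\<in>UNIV. W $ i $ r * (\<alpha> * real t + \<alpha>))"
  proof (rule order_trans[OF norm_sum sum_mono])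
    fix r
    have "norm ((fst st r - x0) - \<alpha> *\<^sub>R u r) \<le> \<alpha> * real t + \<alpha>"
      using Suc.IH[of r] mult_left_le[OF u[of r] \<alpha>] \<alpha>
      by (intro order_trans[OF norm_triangle_ineq4]) (simp add: gt_x_def st_def)
    then show "norm (W $ i $ r *\<^sub>R ((fst st r - x0) - \<alpha> *\<^sub>R u r)) \<le> W $ i $ r * (\<alpha> * real t + \<alpha>)"
      using nonneg[of r] by (simp add: mult_left_mono)
  qed
  also have "\<dots> = \<alpha> * real (Suc t)"
    unfolding sum_distrib_right[symmetric] rows by (simp add: algebra_simps)
  finally show ?case .
qed (simp add: gt_x_def)

(* v^t - v^(t-1) = (1/\<beta> - 1) (g^t - v^t), and W - J annihilates constant vectors. *)
lemma mean_dev_gt_step: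
  assumes W: "doubly_stochastic W" and \<beta>: "\<beta> \<noteq> 0"
  shows "mean_dev (snd (snd (gt_step W \<alpha> \<beta> g s st))) = stack_mult (centered_matrix W)
    (mean_dev (snd (snd st)) + (1 / \<beta> - 1) *\<^sub>R (\<chi> i. g i (fst st i) (s i) - fst (snd (gt_step W \<alpha> \<beta> g s st)) i))"
proof -
  obtain x vold yold where st: "st = (x, vold, yold)" by (cases st) auto
  define v where "v i = \<beta> *\<^sub>R vold i + (1 - \<beta>) *\<^sub>R g i (x i) (s i)" for i
  have step: "fst (snd (gt_step W \<alpha> \<beta> g s st)) = v"
    "snd (snd (gt_step W \<alpha> \<beta> g s st)) = (\<lambda>i. \<Sum>r\<in>UNIV. W $ i $ r *\<^sub>R (yold r + v r - vold r))"
    by (simp_all add: gt_step_def st v_def Let_def fun_eq_iff)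
  have "v r - vold r = (1 / \<beta> - 1) *\<^sub>R (g r (x r) (s r) - v r)" for r
  proof -
    have "(1 / \<beta> - 1) * \<beta> = 1 - \<beta>" using \<beta> by (simp add: field_simps)
    then show ?thesis by (simp add: v_def algebra_simps)
  qed
  then have split: "(\<chi> r. yold r + v r - vold r) = (\<chi> r. yold r) + (1 / \<beta> - 1) *\<^sub>R (\<chi> r. g r (x r) (s r) - v r)"
    by (simp add: vec_eq_iff)
  have "mean_dev (\<lambda>i. \<Sum>r\<in>UNIV. W $ i $ r *\<^sub>R (yold r + v r - vold r))
      = stack_mult (centered_matrix W) (\<chi> r. yold r + v r - vold r)"
    by (simp add: mean_dev_mix[OF W] stack_mult_centered_mean_dev[OF W])
  also have "\<dots> = stack_mult (centered_matrix W) (mean_dev yold + (1 / \<beta> - 1) *\<^sub>R (\<chi> r. g r (x r) (s r) - v r))"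
    unfolding split by (simp add: stack_mult_add stack_mult_centered_mean_dev[OF W])
  finally show ?thesis unfolding step by (simp add: st)
qed

lemma mean_dev_gt_state:
  assumes W: "doubly_stochastic W" and \<beta>: "\<beta> \<noteq> 0"
  shows "mean_dev (snd (snd (gt_state W \<alpha> \<beta> g x0 s t))) = (1 / \<beta> - 1) *\<^sub>R mixing_rec (centered_matrix W)
    (\<lambda>k. \<chi> i. g i (gt_x W \<alpha> \<beta> g x0 s k i) (s i k) - gt_v W \<alpha> \<beta> g x0 s k i) t"
proof (induction t)
  case 0
  then show ?case by (simp add: mean_dev_def vec_eq_iff)
next
  case (Suc t)
  then show ?case
    by (simp add: mean_dev_gt_step[OF W \<beta>] gt_x_def gt_v_def stack_mult_scaleR[symmetric] scaleR_add_right)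
qed

section \<open>Consensus error of the tracking variables\<close>

locale gt_nsgdm = prob_space M
  for M :: "'a measure" and S :: "'s measure"
    and gradf :: "'n::finite \<Rightarrow> 'd::euclidean_space \<Rightarrow> 'd" and g :: "'n \<Rightarrow> 'd \<Rightarrow> 's \<Rightarrow> 'd"
    and \<xi> :: "'n \<Rightarrow> nat \<Rightarrow> 'a \<Rightarrow> 's" and W :: "real^'n^'n" and L p \<sigma> \<alpha> \<beta> :: real and x0 :: 'd +
  assumes smooth: "\<And>i x y. norm (gradf i x - gradf i y) \<le> L * norm (x - y)"
    and xi_meas: "\<And>i k. \<xi> i k \<in> M \<rightarrow>\<^sub>M S"
    and g_meas: "\<And>i. (\<lambda>(x, s). g i x s) \<in> borel \<Otimes>\<^sub>M S \<rightarrow>\<^sub>M borel"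
    and p: "1 < p" "p \<le> 2" and \<sigma>: "\<sigma> \<ge> 0"
    and unbiased: "\<And>i k X. X \<in> borel_measurable (nat_filtr M S \<xi> k) \<Longrightarrow>
        integrable M (\<lambda>\<omega>. g i (X \<omega>) (\<xi> i k \<omega>) - gradf i (X \<omega>)) \<and>
        (\<forall>b\<in>Basis. AE \<omega> in M. real_cond_exp M (nat_filtr M S \<xi> k)
            (\<lambda>\<omega>. (g i (X \<omega>) (\<xi> i k \<omega>) - gradf i (X \<omega>)) \<bullet> b) \<omega> = 0)"
    and moment: "\<And>i k X. X \<in> borel_measurable (nat_filtr M S \<xi> k) \<Longrightarrow>
        AE \<omega> in M. nn_cond_exp M (nat_filtr M S \<xi> k)
            (\<lambda>\<omega>. ennreal (norm (g i (X \<omega>) (\<xi> i k \<omega>) - gradf i (X \<omega>)) powr p)) \<omega>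
          \<le> ennreal (\<sigma> powr p)"
    and W: "doubly_stochastic W" and \<alpha>: "0 \<le> \<alpha>" and \<beta>: "0 < \<beta>" "\<beta> < 1"
begin

abbreviation F :: "nat \<Rightarrow> 'a measure" where
  "F \<equiv> nat_filtr M S \<xi>"

abbreviation iter_x :: "nat \<Rightarrow> 'a \<Rightarrow> 'n \<Rightarrow> 'd" where
  "iter_x k \<omega> \<equiv> gt_x W \<alpha> \<beta> g x0 (\<lambda>j k. \<xi> j k \<omega>) k"

abbreviation iter_v :: "nat \<Rightarrow> 'a \<Rightarrow> 'n \<Rightarrow> 'd" where
  "iter_v k \<omega> \<equiv> gt_v W \<alpha> \<beta> g x0 (\<lambda>j k. \<xi> j k \<omega>) k"

definition noise :: "nat \<Rightarrow> 'a \<Rightarrow> 'd^'n" where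
  "noise k \<omega> = (\<chi> i. g i (iter_x k \<omega> i) (\<xi> i k \<omega>) - gradf i (iter_x k \<omega> i))"

definition tracking_gap :: "nat \<Rightarrow> 'a \<Rightarrow> 'd^'n" where
  "tracking_gap k \<omega> = (\<chi> i. gradf i (iter_x k \<omega> i) - iter_v k \<omega> i)"

lemma subalgebra_F: "subalgebra M (F k)"
  by (rule subalgebra_nat_filtr[OF xi_meas])

lemmas [measurable] = xi_meas g_meas borel_measurable_lipschitz[OF smooth]

lemma iter_x_measurable_F:
  assumes "k \<le> m"
  shows "(\<lambda>\<omega>. iter_x k \<omega> i) \<in> borel_measurable (F m)"
proof -
  have "\<xi> j l \<in> F m \<rightarrow>\<^sub>M S" if "l < k" for j l
    using that assms by (intro measurable_nat_filtr[OF xi_meas]) simp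
  from borel_measurable_gt_state[where g = g and \<xi> = \<xi> and N = "F m" and t = k, OF g_meas this]
  show ?thesis by (simp add: gt_x_def)
qed

lemma iter_measurable [measurable]:
  "(\<lambda>\<omega>. iter_x k \<omega> i) \<in> borel_measurable M" "(\<lambda>\<omega>. iter_v k \<omega> i) \<in> borel_measurable M"
  using borel_measurable_gt_state[where g = g and \<xi> = \<xi> and N = M, OF g_meas xi_meas]
  by (simp_all add: gt_x_def gt_v_def del: gt_state.simps)

lemma noise_measurable_F:
  assumes "k < m"
  shows "noise k \<in> borel_measurable (F m)"
proof -
  have [measurable]: "\<xi> i k \<in> F m \<rightarrow>\<^sub>M S" for i by (rule measurable_nat_filtr[OF xi_meas assms])
  have [measurable]: "(\<lambda>\<omega>. iter_x k \<omega> i) \<in> borel_measurable (F m)" for i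
    using assms by (intro iter_x_measurable_F) simp
  show ?thesis unfolding noise_def by measurable
qed

lemma noise_measurable [measurable]: "noise k \<in> borel_measurable M"
  using measurable_from_subalg[OF subalgebra_F noise_measurable_F[of k "Suc k"]] by simp

lemma tracking_gap_measurable [measurable]: "tracking_gap k \<in> borel_measurable M"
  unfolding tracking_gap_def by measurable

lemma noise_cond_exp_zero:
  assumes "e \<in> Basis"
  shows "AE \<omega> in M. real_cond_exp M (F k) (\<lambda>\<omega>. noise k \<omega> \<bullet> e) \<omega> = 0"
proof -
  obtain i u where e: "e = axis i u" "u \<in> Basis" using assms by (auto simp: Basis_vec_def)
  have "(\<lambda>\<omega>. iter_x k \<omega> i) \<in> borel_measurable (F k)" by (rule iter_x_measurable_F) simp
  from conjunct2[OF unbiased[OF this]] e(2) show ?thesis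
    by (simp add: e noise_def inner_axis)
qed

lemma noise_moment:
  shows "integrable M (\<lambda>\<omega>. norm (noise k \<omega>) powr p)"
    and "(\<integral>\<omega>. norm (noise k \<omega>) powr p \<partial>M) \<le> real CARD('n) * \<sigma> powr p"
proof -
  let ?e = "\<lambda>i \<omega>. norm (noise k \<omega> $ i) powr p"
  have comp: "integrable M (?e i) \<and> (\<integral>\<omega>. ?e i \<omega> \<partial>M) \<le> \<sigma> powr p" for i
  proof -
    have "(\<lambda>\<omega>. iter_x k \<omega> i) \<in> borel_measurable (F k)" by (rule iter_x_measurable_F) simp
    from moment[OF this, of i]
    have ce: "AE \<omega> in M. nn_cond_exp M (F k) (\<lambda>\<omega>. ennreal (?e i \<omega>)) \<omega> \<le> ennreal (\<sigma> powr p)"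
      by (simp add: noise_def)
    have "?e i \<in> borel_measurable M" by (simp add: noise_def) measurable
    from integral_le_of_nn_cond_exp_le[OF subalgebra_F ce this powr_ge_zero powr_ge_zero]
    show ?thesis by blast
  qed
  have pointwise: "norm (noise k \<omega>) powr p \<le> (\<Sum>i\<in>UNIV. ?e i \<omega>)" for \<omega>
    using norm_vec_lambda_powr_le[of p "\<lambda>i. noise k \<omega> $ i"] p by simp
  have sum_int: "integrable M (\<lambda>\<omega>. \<Sum>i\<in>UNIV. ?e i \<omega>)" using comp by simp
  show int: "integrable M (\<lambda>\<omega>. norm (noise k \<omega>) powr p)"
    by (rule Bochner_Integration.integrable_bound[OF sum_int])
      (use pointwise in \<open>auto intro: order_trans[OF _ abs_ge_self]\<close>)
  have "(\<integral>\<omega>. norm (noise k \<omega>) powr p \<partial>M) \<le> (\<integral>\<omega>. (\<Sum>i\<in>UNIV. ?e i \<omega>) \<partial>M)"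
    by (rule integral_mono[OF int sum_int pointwise])
  also have "\<dots> = (\<Sum>i\<in>UNIV. (\<integral>\<omega>. ?e i \<omega> \<partial>M))"
    using comp by (simp add: Bochner_Integration.integral_sum)
  also have "\<dots> \<le> (\<Sum>i\<in>(UNIV :: 'n set). \<sigma> powr p)"
    using comp by (intro sum_mono) blast
  finally show "(\<integral>\<omega>. norm (noise k \<omega>) powr p \<partial>M) \<le> real CARD('n) * \<sigma> powr p" by simp
qed

lemma noise_mixing_integral_le:
  shows "integrable M (\<lambda>\<omega>. norm (mixing_rec (centered_matrix W) (\<lambda>k. noise k \<omega>) t))"
    and "(\<integral>\<omega>. norm (mixing_rec (centered_matrix W) (\<lambda>k. noise k \<omega>) t) \<partial>M)
      \<le> 2 * real CARD('n) powr (1 / p) * \<sigma> * (\<Sum>k<t. mix_lambda W powr (real (t - k) * p)) powr (1 / p)"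
proof -
  let ?Z = "\<lambda>\<omega>. norm (mixing_rec (centered_matrix W) (\<lambda>k. noise k \<omega>) t)"
  let ?S = "\<Sum>k<t. mix_lambda W powr (real (t - k) * p)"
  have Zm: "?Z \<in> borel_measurable M"
    using borel_measurable_mixing_rec[of t noise M] by measurable
  have "integrable M (\<lambda>\<omega>. ?Z \<omega> powr p) \<and> (\<integral>\<omega>. ?Z \<omega> powr p \<partial>M) \<le> 2 powr p * (real CARD('n) * \<sigma> powr p) * ?S"
    using mixing_rec_moment_le[OF p subalgebra_F noise_measurable_F noise_moment noise_cond_exp_zero]
    by (simp add: mix_lambda_eq_onorm)
  then have Zp: "integrable M (\<lambda>\<omega>. ?Z \<omega> powr p)"
    and Zp_le: "(\<integral>\<omega>. ?Z \<omega> powr p \<partial>M) \<le> 2 powr p * (real CARD('n) * \<sigma> powr p) * ?S" by auto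
  show "integrable M ?Z" using integrable_of_integrable_powr[OF _ Zm _ Zp] p by simp
  have "(\<integral>\<omega>. ?Z \<omega> \<partial>M) \<le> (\<integral>\<omega>. ?Z \<omega> powr p \<partial>M) powr (1 / p)"
    using integral_le_integral_powr_root[OF p(1) Zm _ Zp] by simp
  also have "\<dots> \<le> (2 powr p * (real CARD('n) * \<sigma> powr p) * ?S) powr (1 / p)"
    using Zp_le p by (intro powr_mono2) (auto intro: integral_nonneg_AE)
  also have "\<dots> = 2 * real CARD('n) powr (1 / p) * \<sigma> * ?S powr (1 / p)"
    using p \<sigma> by (simp add: powr_mult powr_powr)
  finally show "(\<integral>\<omega>. ?Z \<omega> \<partial>M) \<le> 2 * real CARD('n) powr (1 / p) * \<sigma> * ?S powr (1 / p)" .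
qed

lemma gradf_iter_integrable: "integrable M (\<lambda>\<omega>. gradf i (iter_x k \<omega> i))"
proof (rule integrable_const_bound)
  show "AE \<omega> in M. norm (gradf i (iter_x k \<omega> i)) \<le> norm (gradf i x0) + \<bar>L\<bar> * (\<alpha> * real k)"
  proof (rule AE_I2)
    fix \<omega>
    have "norm (gradf i (iter_x k \<omega> i) - gradf i x0) \<le> \<bar>L\<bar> * norm (iter_x k \<omega> i - x0)"
      using smooth[of i "iter_x k \<omega> i" x0] by (smt (verit) abs_ge_self mult_right_mono norm_ge_zero)
    also have "\<dots> \<le> \<bar>L\<bar> * (\<alpha> * real k)"
      using norm_gt_x_diff_le[OF W \<alpha>] by (intro mult_left_mono) auto
    finally show "norm (gradf i (iter_x k \<omega> i)) \<le> norm (gradf i x0) + \<bar>L\<bar> * (\<alpha> * real k)"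
      using norm_triangle_ineq2[of "gradf i (iter_x k \<omega> i)" "gradf i x0"] by linarith
  qed
qed measurable

lemma g_iter_integrable: "integrable M (\<lambda>\<omega>. g i (iter_x k \<omega> i) (\<xi> i k \<omega>))"
proof -
  have "(\<lambda>\<omega>. iter_x k \<omega> i) \<in> borel_measurable (F k)" by (rule iter_x_measurable_F) simp
  from conjunct1[OF unbiased[OF this]] gradf_iter_integrable[of i k]
  have "integrable M (\<lambda>\<omega>. (g i (iter_x k \<omega> i) (\<xi> i k \<omega>) - gradf i (iter_x k \<omega> i)) + gradf i (iter_x k \<omega> i))"
    by (rule Bochner_Integration.integrable_add)
  then show ?thesis by simp
qed

lemma iter_v_integrable: "integrable M (\<lambda>\<omega>. iter_v k \<omega> i)"
proof (induction k)
  case 0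
  then show ?case using g_iter_integrable[of i 0] by (simp add: gt_v_0 gt_x_def)
next
  case (Suc k)
  then show ?case using g_iter_integrable[of i "Suc k"] by (simp add: gt_v_Suc)
qed

lemma tracking_gap_integrable: "integrable M (\<lambda>\<omega>. norm (tracking_gap k \<omega>))"
proof (rule Bochner_Integration.integrable_bound)
  show "integrable M (\<lambda>\<omega>. \<Sum>i\<in>UNIV. norm (gradf i (iter_x k \<omega> i) - iter_v k \<omega> i))"
    by (intro Bochner_Integration.integrable_sum integrable_norm Bochner_Integration.integrable_diff
        gradf_iter_integrable iter_v_integrable)
  show "AE \<omega> in M. norm (norm (tracking_gap k \<omega>)) \<le> norm (\<Sum>i\<in>UNIV. norm (gradf i (iter_x k \<omega> i) - iter_v k \<omega> i))"
    using norm_vec_le_sum_norm[of "tracking_gap _ _"] by (intro AE_I2) (simp add: tracking_gap_def sum_nonneg)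
qed measurable

lemma mean_dev_iter_y:
  "mean_dev (gt_y W \<alpha> \<beta> g x0 (\<lambda>j k. \<xi> j k \<omega>) t) = (1 / \<beta> - 1) *\<^sub>R
    (mixing_rec (centered_matrix W) (\<lambda>k. noise k \<omega>) (Suc t)
      + mixing_rec (centered_matrix W) (\<lambda>k. tracking_gap k \<omega>) (Suc t))"
proof -
  have "(\<chi> i. g i (iter_x k \<omega> i) (\<xi> i k \<omega>) - iter_v k \<omega> i) = noise k \<omega> + tracking_gap k \<omega>" for k
    by (simp add: noise_def tracking_gap_def vec_eq_iff)
  then show ?thesis
    using mean_dev_gt_state[OF W, of \<beta> \<alpha> g x0 "\<lambda>j k. \<xi> j k \<omega>" "Suc t"] \<beta>
    by (simp add: gt_y_def mixing_rec_add)
qed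

lemma consensus_error_le:
  "(\<Sum>i\<in>UNIV. norm (gt_y W \<alpha> \<beta> g x0 (\<lambda>j k. \<xi> j k \<omega>) t i
      - (1 / real CARD('n)) *\<^sub>R (\<Sum>r\<in>UNIV. gt_y W \<alpha> \<beta> g x0 (\<lambda>j k. \<xi> j k \<omega>) t r)))
    \<le> sqrt (real CARD('n)) * (1 / \<beta> - 1) * (norm (mixing_rec (centered_matrix W) (\<lambda>k. noise k \<omega>) (Suc t))
      + (\<Sum>k\<le>t. mix_lambda W ^ (t - k + 1) * norm (tracking_gap k \<omega>)))"
  (is "?lhs \<le> sqrt ?n * ?a * (norm ?N + ?T)")
proof -
  let ?G = "mixing_rec (centered_matrix W) (\<lambda>k. tracking_gap k \<omega>) (Suc t)"
  have a: "0 \<le> ?a" using \<beta> by simp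
  have "norm ?G \<le> (\<Sum>k<Suc t. mix_lambda W ^ (Suc t - k) * norm (tracking_gap k \<omega>))"
    unfolding mix_lambda_eq_onorm by (rule norm_mixing_rec_le)
  also have "\<dots> = ?T" unfolding lessThan_Suc_atMost by (intro sum.cong) (auto simp: Suc_diff_le)
  finally have G: "norm ?G \<le> ?T" .
  have "?lhs = (\<Sum>i\<in>UNIV. norm (mean_dev (gt_y W \<alpha> \<beta> g x0 (\<lambda>j k. \<xi> j k \<omega>) t) $ i))"
    by (simp add: mean_dev_def)
  also have "\<dots> \<le> sqrt ?n * norm (mean_dev (gt_y W \<alpha> \<beta> g x0 (\<lambda>j k. \<xi> j k \<omega>) t))"
    by (rule sum_norm_le_sqrt_card_mult_norm)
  also have "\<dots> \<le> sqrt ?n * (?a * (norm ?N + ?T))"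
    unfolding mean_dev_iter_y using a G
    by (intro mult_left_mono) (auto intro!: mult_left_mono order_trans[OF norm_triangle_ineq])
  finally show ?thesis by (simp add: mult.assoc)
qed

lemma integral_consensus_error_le:
  "expectation (\<lambda>\<omega>. \<Sum>i\<in>UNIV. norm (gt_y W \<alpha> \<beta> g x0 (\<lambda>j k. \<xi> j k \<omega>) t i
      - (1 / real CARD('n)) *\<^sub>R (\<Sum>r\<in>UNIV. gt_y W \<alpha> \<beta> g x0 (\<lambda>j k. \<xi> j k \<omega>) t r)))
    \<le> sqrt (real CARD('n)) * (1 / \<beta> - 1)
      * (expectation (\<lambda>\<omega>. norm (mixing_rec (centered_matrix W) (\<lambda>k. noise k \<omega>) (Suc t)))
        + (\<Sum>k\<le>t. mix_lambda W ^ (t - k + 1) * expectation (\<lambda>\<omega>. norm (tracking_gap k \<omega>))))"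
  (is "expectation ?E \<le> sqrt ?n * ?a * (expectation ?N + _)")
proof -
  define T where "T \<omega> = (\<Sum>k\<le>t. mix_lambda W ^ (t - k + 1) * norm (tracking_gap k \<omega>))" for \<omega>
  have Nint: "integrable M ?N" by (rule noise_mixing_integral_le(1))
  have Tint: "integrable M T" unfolding T_def using tracking_gap_integrable by simp
  have "0 \<le> mix_lambda W" unfolding mix_lambda_eq_onorm by (rule onorm_pos_le) simp
  then have "0 \<le> ?N \<omega> + T \<omega>" for \<omega> by (simp add: T_def sum_nonneg)
  moreover have "?E \<omega> \<le> sqrt ?n * ?a * (?N \<omega> + T \<omega>)" for \<omega>
    unfolding T_def by (rule consensus_error_le)
  ultimately have "expectation ?E \<le> (\<integral>\<omega>. sqrt ?n * ?a * (?N \<omega> + T \<omega>) \<partial>M)"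
    using Nint Tint \<beta> by (intro integral_mono') auto
  also have "\<dots> = sqrt ?n * ?a * (expectation ?N + expectation T)"
    using Nint Tint by simp
  also have "expectation T = (\<Sum>k\<le>t. mix_lambda W ^ (t - k + 1) * expectation (\<lambda>\<omega>. norm (tracking_gap k \<omega>)))"
    using tracking_gap_integrable by (simp add: T_def[abs_def])
  finally show ?thesis .
qed

lemma noise_term_le:
  "expectation (\<lambda>\<omega>. norm (mixing_rec (centered_matrix W) (\<lambda>k. noise k \<omega>) (Suc t))) / sqrt (real CARD('n))
    \<le> 2 * sqrt 2 * sqrt (real CARD('n)) * \<sigma> * (\<Sum>k\<le>t. mix_lambda W powr (real (t - k + 1) * p)) powr (1 / p)"
  (is "?I / sqrt ?n \<le> 2 * sqrt 2 * sqrt ?n * \<sigma> * ?S powr (1 / p)")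
proof -
  have n: "1 \<le> ?n" by (simp add: Suc_le_eq)
  have "?n powr (1 / p) \<le> ?n" using n p powr_mono[of "1 / p" 1 ?n] by simp
  also have "\<dots> = 1 * ?n" by simp
  also have "\<dots> \<le> sqrt 2 * ?n" by (rule mult_right_mono) auto
  finally have root: "2 * ?n powr (1 / p) * \<sigma> * ?S powr (1 / p) \<le> 2 * (sqrt 2 * ?n) * \<sigma> * ?S powr (1 / p)"
    using \<sigma> by (intro mult_right_mono mult_left_mono) auto
  have "(\<Sum>k<Suc t. mix_lambda W powr (real (Suc t - k) * p)) = ?S"
    unfolding lessThan_Suc_atMost by (intro sum.cong) (auto simp: Suc_diff_le)
  then have "?I \<le> 2 * ?n powr (1 / p) * \<sigma> * ?S powr (1 / p)"
    using noise_mixing_integral_le(2)[of "Suc t"] by simp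
  also note root
  also have "2 * (sqrt 2 * ?n) * \<sigma> * ?S powr (1 / p) = 2 * (sqrt 2 * (sqrt ?n * sqrt ?n)) * \<sigma> * ?S powr (1 / p)"
    by simp
  also have "\<dots> = (2 * sqrt 2 * sqrt ?n * \<sigma> * ?S powr (1 / p)) * sqrt ?n" by (simp only: ac_simps)
  finally show ?thesis using n by (subst pos_divide_le_eq) auto
qed

theorem consensus_error_bound:
  "(1 / real CARD('n)) * expectation (\<lambda>\<omega>.
      \<Sum>i\<in>UNIV. norm (gt_y W \<alpha> \<beta> g x0 (\<lambda>j k. \<xi> j k \<omega>) t i
        - (1 / real CARD('n)) *\<^sub>R (\<Sum>r\<in>UNIV. gt_y W \<alpha> \<beta> g x0 (\<lambda>j k. \<xi> j k \<omega>) t r)))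
   \<le> 2 * sqrt 2 * sqrt (real CARD('n)) * (1 / \<beta> - 1)
        * (\<Sum>k\<le>t. mix_lambda W powr (real (t - k + 1) * p)) powr (1 / p) * \<sigma>
     + (1 / sqrt (real CARD('n))) * (1 / \<beta> - 1)
        * (\<Sum>k\<le>t. mix_lambda W ^ (t - k + 1) * expectation (\<lambda>\<omega>.
            stack_norm (\<lambda>i. gradf i (gt_x W \<alpha> \<beta> g x0 (\<lambda>j k. \<xi> j k \<omega>) k i)
                            - gt_v W \<alpha> \<beta> g x0 (\<lambda>j k. \<xi> j k \<omega>) k i)))"
  (is "(1 / ?n) * expectation ?E \<le> 2 * sqrt 2 * sqrt ?n * ?a * ?S powr (1 / p) * \<sigma> + (1 / sqrt ?n) * ?a * ?T")
proof -
  let ?I = "expectation (\<lambda>\<omega>. norm (mixing_rec (centered_matrix W) (\<lambda>k. noise k \<omega>) (Suc t)))"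
  have a: "0 \<le> ?a" using \<beta> by simp
  have "(1 / ?n) * expectation ?E
      \<le> (1 / ?n) * (sqrt ?n * ?a * (?I + (\<Sum>k\<le>t. mix_lambda W ^ (t - k + 1)
        * expectation (\<lambda>\<omega>. norm (tracking_gap k \<omega>)))))"
    by (rule mult_left_mono[OF integral_consensus_error_le]) simp
  also have "\<dots> = ?a * (?I / sqrt ?n) + (1 / sqrt ?n) * ?a * ?T"
    using real_sqrt_mult_self[of ?n] by (simp add: stack_norm_eq_norm tracking_gap_def field_simps)
  also have "?a * (?I / sqrt ?n) \<le> ?a * (2 * sqrt 2 * sqrt ?n * \<sigma> * ?S powr (1 / p))"
    using noise_term_le a by (rule mult_left_mono)
  finally show ?thesis by (simp add: algebra_simps)
qed

end

theorem lemma6: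
  fixes M :: "'a measure" and S :: "'s measure"
    and f :: "'n::finite \<Rightarrow> 'd::euclidean_space \<Rightarrow> real" and gradf :: "'n \<Rightarrow> 'd \<Rightarrow> 'd"
    and g :: "'n \<Rightarrow> 'd \<Rightarrow> 's \<Rightarrow> 'd" and \<xi> :: "'n \<Rightarrow> nat \<Rightarrow> 'a \<Rightarrow> 's"
    and W :: "real^'n^'n" and L p \<sigma> \<alpha> \<beta> :: real and x0 :: 'd and t :: nat
  assumes prob: "prob_space M"
    and grad: "\<And>i x. (f i has_derivative (\<lambda>h. gradf i x \<bullet> h)) (at x)"
    and smooth: "\<And>i x y. norm (gradf i x - gradf i y) \<le> L * norm (x - y)"
    and xi_meas: "\<And>i k. \<xi> i k \<in> M \<rightarrow>\<^sub>M S"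
    and g_meas: "\<And>i. (\<lambda>(x, s). g i x s) \<in> borel \<Otimes>\<^sub>M S \<rightarrow>\<^sub>M borel"
    and p: "1 < p" "p \<le> 2" and \<sigma>: "\<sigma> \<ge> 0"
    and unbiased: "\<And>i k X. X \<in> borel_measurable (nat_filtr M S \<xi> k) \<Longrightarrow>
        integrable M (\<lambda>\<omega>. g i (X \<omega>) (\<xi> i k \<omega>) - gradf i (X \<omega>)) \<and>
        (\<forall>b\<in>Basis. AE \<omega> in M. real_cond_exp M (nat_filtr M S \<xi> k)
            (\<lambda>\<omega>. (g i (X \<omega>) (\<xi> i k \<omega>) - gradf i (X \<omega>)) \<bullet> b) \<omega> = 0)"
    and moment: "\<And>i k X. X \<in> borel_measurable (nat_filtr M S \<xi> k) \<Longrightarrow>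
        AE \<omega> in M. nn_cond_exp M (nat_filtr M S \<xi> k)
            (\<lambda>\<omega>. ennreal (norm (g i (X \<omega>) (\<xi> i k \<omega>) - gradf i (X \<omega>)) powr p)) \<omega>
          \<le> ennreal (\<sigma> powr p)"
    and indep: "prob_space.indep_vars M (\<lambda>_. S) (\<lambda>(i, k). \<xi> i k) UNIV"
    and Wds: "doubly_stochastic W" and Wprim: "primitive_matrix W"
    and lam: "mix_lambda W < 1"
    and \<alpha>: "\<alpha> > 0" and \<beta>: "0 < \<beta>" "\<beta> < 1"
  shows
    "(1 / real CARD('n)) * prob_space.expectation M (\<lambda>\<omega>.
        \<Sum>i\<in>UNIV. norm (gt_y W \<alpha> \<beta> g x0 (\<lambda>j k. \<xi> j k \<omega>) t i
          - (1 / real CARD('n)) *\<^sub>R (\<Sum>r\<in>UNIV. gt_y W \<alpha> \<beta> g x0 (\<lambda>j k. \<xi> j k \<omega>) t r)))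
     \<le> 2 * sqrt 2 * sqrt (real CARD('n)) * (1 / \<beta> - 1)
          * (\<Sum>k\<le>t. mix_lambda W powr (real (t - k + 1) * p)) powr (1 / p) * \<sigma>
       + (1 / sqrt (real CARD('n))) * (1 / \<beta> - 1)
          * (\<Sum>k\<le>t. mix_lambda W ^ (t - k + 1) * prob_space.expectation M (\<lambda>\<omega>.
              stack_norm (\<lambda>i. gradf i (gt_x W \<alpha> \<beta> g x0 (\<lambda>j k. \<xi> j k \<omega>) k i)
                              - gt_v W \<alpha> \<beta> g x0 (\<lambda>j k. \<xi> j k \<omega>) k i)))"
proof -
  interpret gt_nsgdm M S gradf g \<xi> W L p \<sigma> \<alpha> \<beta> x0
    using prob smooth xi_meas g_meas p \<sigma> unbiased moment Wds \<alpha> \<beta>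
    by (intro gt_nsgdm.intro gt_nsgdm_axioms.intro) auto
  show ?thesis by (rule consensus_error_bound)
qed

end
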